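(* Let $1\le i_1<i_2<\dots<i_k<n$, and let $m=i_1+\dots+i_k$. There is a bijection $$\{\pi\in\mathcal I_n(321):\mathrm{Des}(\pi)=\{i_1,i_2,...,i_k\}\}\longrightarrow \{\lambda\vdash m:\mathrm{hd}(\lambda)=\{i_1,i_2,\dots,i_k\},\lambda\subseteq B_n\}.$$
   Context: $\mathcal I_n(321)$ is the set of $321$-avoiding involutions of $\{1,\dots,n\}$; $\mathrm{Des}(\pi)$ is the set of descent positions $i$ with $\pi(i)>\pi(i+1)$. $B_n$ is the $\lfloor n/2\rfloor\times\lceil n/2\rceil$ box, and $\lambda\subseteq B_n$ means the Young diagram of $\lambda$ fits inside it (at most $\lfloor n/2\rfloor$ parts, each at most $\lceil n/2\rceil$). The hook decomposition $\mathrm{hd}(\lambda)=\{i_1<\dots<i_k\}$ is defined as follows: $k$ is the side of the Durfee square of $\lambda$; $i_k$ is the number of boxes in the largest hook (first row together with first column); removing it, $i_{k-1}$ is the number of boxes in the largest hook of the remaining diagram, and so on recursively. *)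

theory Defs
  imports Main "HOL-Combinatorics.Permutations"
begin

definition avoids_321 :: "nat \<Rightarrow> (nat \<Rightarrow> nat) \<Rightarrow> bool" where
  "avoids_321 n \<pi> \<longleftrightarrow>
     \<not> (\<exists>a\<in>{1..n}. \<exists>b\<in>{1..n}. \<exists>c\<in>{1..n}. a < b \<and> b < c \<and> \<pi> a > \<pi> b \<and> \<pi> b > \<pi> c)"

definition involutions_321 :: "nat \<Rightarrow> (nat \<Rightarrow> nat) set" where
  "involutions_321 n = {\<pi>. \<pi> permutes {1..n} \<and> \<pi> \<circ> \<pi> = id \<and> avoids_321 n \<pi>}"

definition descents :: "nat \<Rightarrow> (nat \<Rightarrow> nat) \<Rightarrow> nat set" where
  "descents n \<pi> = {i. 1 \<le> i \<and> i < n \<and> \<pi> i > \<pi> (i + 1)}"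

text \<open>A partition of \<open>m\<close> is the weakly decreasing list of its positive parts.\<close>

definition is_partition :: "nat list \<Rightarrow> nat \<Rightarrow> bool" where
  "is_partition ps m \<longleftrightarrow> sorted_wrt (\<ge>) ps \<and> 0 \<notin> set ps \<and> sum_list ps = m"

text \<open>Boxes are pairs (row, column), both counted from 0.\<close>

definition young :: "nat list \<Rightarrow> (nat \<times> nat) set" where
  "young ps = {(r, c). r < length ps \<and> c < ps ! r}"

definition box :: "nat \<Rightarrow> (nat \<times> nat) set" where
  "box n = {..<n div 2} \<times> {..<(n + 1) div 2}"

definition durfee :: "(nat \<times> nat) set \<Rightarrow> nat" where
  "durfee Y = Max {d. {..<d} \<times> {..<d} \<subseteq> Y}"

definition largest_hook :: "(nat \<times> nat) set \<Rightarrow> (nat \<times> nat) set" where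
  "largest_hook Y = {(r, c) \<in> Y. r = 0 \<or> c = 0}"

text \<open>The boxes outside the largest hook, moved one step up and to the left so that they form
  a Young diagram again.\<close>

definition remove_hook :: "(nat \<times> nat) set \<Rightarrow> (nat \<times> nat) set" where
  "remove_hook Y = {(r, c). (Suc r, Suc c) \<in> Y}"

text \<open>With \<open>k\<close> the side of the Durfee square, the hook present after \<open>j\<close> removals has
  \<open>i\<^sub>k\<^sub>-\<^sub>j\<close> boxes, for \<open>j = 0, \<dots>, k - 1\<close>.\<close>

definition hook_decomposition :: "nat list \<Rightarrow> nat set" where
  "hook_decomposition ps =
     (\<lambda>j. card (largest_hook ((remove_hook ^^ j) (young ps)))) ` {..<durfee (young ps)}"

end

theory Submission imports Defs "HOL-Library.Infinite_Set" begin

text \<open>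
  Both sides are encoded by strict chains \<open>S \<subseteq> {1..\<lceil>n/2\<rceil>} \<times> {0..<\<lfloor>n/2\<rfloor>}\<close> whose coordinate sums form \<open>D\<close>.

  A partition is determined by the Frobenius coordinates of its diagonal boxes, which form such a
  chain, the sums being the sizes of the hooks.

  In a 321-avoiding involution no arc \<open>i < \<pi> i\<close> contains another arc or a fixed point, so \<open>\<pi>\<close> is a
  Motzkin path with up-steps at the openers, down-steps at the closers, and flat steps at height 0 only.
  Turning the first half of the flat steps (rounded down) into down-steps and the others into up-steps
  gives an arbitrary word with \<open>\<lceil>n/2\<rceil>\<close> up-steps and \<open>\<lfloor>n/2\<rfloor>\<close> down-steps. It is represented by the set \<open>U\<close>
  of positions of its up-steps. The descents of \<open>\<pi>\<close> are the peaks of the word, and the numbers of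
  up-steps and down-steps before the peaks form a chain that determines the word.
\<close>

subsection \<open>Strict chains\<close>

text \<open>Applied to both orders of a pair, the equivalence makes points that share one coordinate
  equal, so distinct points differ strictly, and in the same direction, in both coordinates.\<close>

definition strict_chain :: "(nat \<times> nat) set \<Rightarrow> bool" where
  "strict_chain S \<longleftrightarrow> (\<forall>x\<in>S. \<forall>y\<in>S. fst x < fst y \<longleftrightarrow> snd x < snd y)"

lemma strict_chainD: "strict_chain S \<Longrightarrow> x \<in> S \<Longrightarrow> y \<in> S \<Longrightarrow> fst x < fst y \<longleftrightarrow> snd x < snd y"
  unfolding strict_chain_def by blast

lemma strict_chain_subset: "strict_chain S \<Longrightarrow> T \<subseteq> S \<Longrightarrow> strict_chain T"
  unfolding strict_chain_def by blast

text \<open>Along a chain both coordinates grow, hence so does the sum. The set of hook sizes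
  therefore loses no multiplicities.\<close>

lemma strict_chain_inj_on_sum:
  assumes "strict_chain S" shows "inj_on (\<lambda>(a, b). a + b) S"
proof (rule inj_onI)
  fix x y assume xy: "x \<in> S" "y \<in> S" and eq: "(\<lambda>(a, b). a + b) x = (\<lambda>(a, b). a + b) y"
  have "fst x < fst y \<longleftrightarrow> snd x < snd y" "fst y < fst x \<longleftrightarrow> snd y < snd x"
    using assms xy unfolding strict_chain_def by blast+
  with eq show "x = y" by (cases x, cases y) (auto split: prod.splits)
qed

lemma strict_chain_insert:
  assumes "strict_chain S" and "S \<subseteq> {..<a} \<times> {..<b}"
  shows "strict_chain (insert (a, b) S)"
  using assms unfolding strict_chain_def by fastforce

lemma strict_chain_remove_max:
  assumes ch: "strict_chain S" and fin: "finite S" and ne: "S \<noteq> {}"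
  obtains a b where "(a, b) \<in> S" and "S - {(a, b)} \<subseteq> {..<a} \<times> {..<b}"
proof -
  have "Max (fst ` S) \<in> fst ` S" using fin ne by simp
  then obtain a b where ab: "(a, b) \<in> S" "a = Max (fst ` S)" by force
  have "x < a \<and> y < b" if "(x, y) \<in> S - {(a, b)}" for x y
  proof -
    have "x \<le> a" using that ab fin by (auto intro!: Max_ge image_eqI[of _ fst "(x,y)"])
    moreover have "x < a \<longleftrightarrow> y < b" "a < x \<longleftrightarrow> b < y"
      using strict_chainD[OF ch, of "(x, y)" "(a, b)"] strict_chainD[OF ch, of "(a, b)" "(x, y)"]
        that ab(1) by auto
    ultimately show ?thesis using that by auto
  qed
  then have "S - {(a, b)} \<subseteq> {..<a} \<times> {..<b}" by auto
  then show thesis using that ab(1) by blast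
qed

text \<open>Each of the two top points occurs on the other side, hence lies weakly below the other.
  This reads the outermost hook off a chain.\<close>

lemma strict_chain_max_unique:
  fixes a b c d :: nat
  assumes "insert (a, b) S = insert (c, d) T"
    and "S \<subseteq> {..<a} \<times> {..<b}" and "T \<subseteq> {..<c} \<times> {..<d}"
  shows "a = c \<and> b = d \<and> S = T"
proof -
  have "(a, b) \<in> insert (c, d) T" "(c, d) \<in> insert (a, b) S" using assms(1) by blast+
  then have "a \<le> c" "b \<le> d" "c \<le> a" "d \<le> b" using assms(2,3) by auto
  then have "a = c" "b = d" by auto
  moreover have "(a, b) \<notin> S" "(c, d) \<notin> T" using assms(2,3) by auto
  ultimately show ?thesis using assms(1) by auto
qed

text \<open>Chains grow at the top: this matches a hook wrapped around a diagram, and a last peak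
  appended to a word.\<close>

lemma strict_chain_induct [consumes 2, case_names empty insert]:
  assumes "finite S" and "strict_chain S"
    and "P {}"
    and "\<And>a b S. finite S \<Longrightarrow> strict_chain S \<Longrightarrow> S \<subseteq> {..<a} \<times> {..<b} \<Longrightarrow> P S \<Longrightarrow> P (insert (a, b) S)"
  shows "P S"
  using assms(1,2)
proof (induction rule: finite_psubset_induct)
  case (psubset S)
  show ?case
  proof (cases "S = {}")
    case False
    then obtain a b where ab: "(a, b) \<in> S" "S - {(a, b)} \<subseteq> {..<a} \<times> {..<b}"
      using strict_chain_remove_max psubset by metis
    moreover have "P (S - {(a, b)})"
      using psubset ab(1) strict_chain_subset[of S "S - {(a, b)}"] by blast
    ultimately have "P (insert (a, b) (S - {(a, b)}))"
      using assms(4) psubset strict_chain_subset[of S "S - {(a, b)}"] by blast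
    then show ?thesis using ab(1) by (simp add: insert_absorb)
  qed (simp add: assms(3))
qed

subsection \<open>Frobenius coordinates of partitions\<close>

text \<open>Dropping the head of a list and stripping the rest removes the first row and the first
  column of the diagram. Rows of length 1 disappear, so that no zero parts arise.\<close>

definition strip_column :: "nat list \<Rightarrow> nat list" where
  "strip_column xs = map (\<lambda>x. x - 1) (filter (\<lambda>x. 1 < x) xs)"

text \<open>The coordinates are (arm length + 1, leg length) of the diagonal boxes, so that each pair
  sums to the size of its hook.\<close>

function frobenius :: "nat list \<Rightarrow> (nat \<times> nat) set" where
  "frobenius [] = {}"
| "frobenius (x # xs) = insert (x, length xs) (frobenius (strip_column xs))"
  by pat_completeness auto
termination by (relation "measure length") (auto simp: strip_column_def le_imp_less_Suc)

definition partition_list :: "nat list \<Rightarrow> bool" where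
  "partition_list ps \<longleftrightarrow> sorted_wrt (\<ge>) ps \<and> 0 \<notin> set ps"

lemma partition_strip_column:
  assumes "partition_list (x # xs)" shows "partition_list (strip_column xs)"
proof -
  have "sorted_wrt (\<ge>) (filter (\<lambda>x. 1 < x) xs)"
    using assms by (simp add: partition_list_def sorted_wrt_filter)
  then have "sorted_wrt (\<lambda>x y. y - 1 \<le> x - 1) (filter (\<lambda>x. 1 < x) xs)"
    by (rule sorted_wrt_mono_rel[rotated]) auto
  then show ?thesis by (auto simp: partition_list_def strip_column_def sorted_wrt_map)
qed

lemma partition_induct [consumes 1, case_names Nil Cons]:
  assumes "partition_list ps" and "P []"
    and "\<And>x xs. partition_list (x # xs) \<Longrightarrow> P (strip_column xs) \<Longrightarrow> P (x # xs)"
  shows "P ps"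
  using assms(1)
proof (induction ps rule: frobenius.induct)
  case (2 x xs)
  then show ?case using assms(3) partition_strip_column by blast
qed (rule assms(2))

lemma length_strip_column: "length (strip_column xs) \<le> length xs"
  by (simp add: strip_column_def)

lemma set_strip_column_less: "\<forall>y\<in>set xs. y < Suc a \<Longrightarrow> y \<in> set (strip_column xs) \<Longrightarrow> y < a"
  by (auto simp: strip_column_def)

text \<open>Stripping shortens rows and adds none, so bounds for the outermost pair serve for all
  inner pairs.\<close>

lemma frobenius_bounded:
  assumes "partition_list ps" and "\<forall>y\<in>set ps. y < Suc a" and "length ps \<le> b"
  shows "frobenius ps \<subseteq> {1..a} \<times> {..<b}"
  using assms
proof (induction arbitrary: a b rule: partition_induct)
  case (Cons x xs)
  have "frobenius (strip_column xs) \<subseteq> {1..a} \<times> {..<b}"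
    using Cons.prems length_strip_column[of xs] set_strip_column_less[of xs a]
    by (intro Cons.IH) (auto simp: less_Suc_eq)
  moreover have "1 \<le> x" using Cons.hyps by (cases x) (auto simp: partition_list_def)
  ultimately show ?case using Cons.prems by auto
qed simp

text \<open>The rows of \<open>xs\<close> are no longer than \<open>x\<close> and lose a box each,
  so the inner first coordinates are strictly smaller. Thus the outermost pair is the top of the
  chain.\<close>

lemma frobenius_strip_column:
  assumes "partition_list (x # xs)"
  shows "frobenius (strip_column xs) \<subseteq> {1..<x} \<times> {..<length xs}"
proof -
  have "frobenius (strip_column xs) \<subseteq> {1..x - 1} \<times> {..<length xs}"
  proof (intro frobenius_bounded partition_strip_column[OF assms] length_strip_column ballI)
    fix y assume "y \<in> set (strip_column xs)"
    moreover have "\<forall>y\<in>set xs. y < Suc x" using assms by (auto simp: partition_list_def)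
    ultimately have "y < x" using set_strip_column_less by blast
    then show "y < Suc (x - 1)" by simp
  qed
  moreover have "{1..x - 1} \<times> {..<length xs} \<subseteq> {1..<x} \<times> {..<length xs}" by auto
  ultimately show ?thesis by (rule subset_trans)
qed

lemma finite_frobenius: "finite (frobenius ps)"
  by (induction ps rule: frobenius.induct) auto

lemma strict_chain_frobenius: "partition_list ps \<Longrightarrow> strict_chain (frobenius ps)"
proof (induction rule: partition_induct)
  case (Cons x xs)
  then show ?case using frobenius_strip_column[OF Cons(1)]
    by (auto intro!: strict_chain_insert)
qed (simp add: strict_chain_def)

text \<open>The rows lost by stripping have length 1 and stand at the end, so the stripped list and
  the number of rows determine \<open>xs\<close>.\<close>

lemma partition_eq_strip_column:
  assumes "sorted_wrt (\<ge>) xs" and "0 \<notin> set xs"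
  shows "xs = map Suc (strip_column xs) @ replicate (length xs - length (strip_column xs)) 1"
  using assms
proof (induction xs)
  case (Cons x xs)
  show ?case
  proof (cases "1 < x")
    case True
    then show ?thesis using Cons.IH Cons.prems by (simp add: strip_column_def)
  next
    case False
    then have "y = 1" if "y \<in> set (x # xs)" for y
    proof -
      have "y \<le> x" using Cons.prems that by auto
      moreover have "y \<noteq> 0" using Cons.prems(2) that by metis
      ultimately show ?thesis using False by simp
    qed
    then have all: "\<forall>y\<in>set (x # xs). y = 1" by blast
    then have *: "x # xs = replicate (length (x # xs)) 1"
      using replicate_length_same[of "x # xs" 1] by simp
    have "filter (\<lambda>x. 1 < x) (x # xs) = []"
      using all by (auto simp: filter_empty_conv)
    then have strip: "strip_column (x # xs) = []"
      by (simp only: strip_column_def list.map)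
    show ?thesis
      unfolding strip list.map append_Nil list.size(3) minus_nat.diff_0 by (rule *)
  qed
qed (simp add: strip_column_def)

text \<open>The top of the chain gives the first part and the number of parts. The rest is the chain
  of the stripped list, from which \<open>partition_eq_strip_column\<close> rebuilds the other
  rows.\<close>

lemma frobenius_inj:
  assumes "partition_list ps" and "partition_list qs" and "frobenius ps = frobenius qs"
  shows "ps = qs"
  using assms
proof (induction arbitrary: qs rule: partition_induct)
  case Nil
  then show ?case by (cases qs) auto
next
  case (Cons x xs)
  then obtain y ys where qs: "qs = y # ys" by (cases qs) auto
  have "frobenius (strip_column xs) \<subseteq> {..<x} \<times> {..<length xs}"
    using frobenius_strip_column[OF Cons.hyps] by auto
  moreover have "frobenius (strip_column ys) \<subseteq> {..<y} \<times> {..<length ys}"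
    using frobenius_strip_column[of y ys] Cons.prems qs by auto
  ultimately have eq: "x = y" "length xs = length ys"
    and fr: "frobenius (strip_column xs) = frobenius (strip_column ys)"
    using strict_chain_max_unique[of x "length xs" _ y "length ys"] Cons.prems(2)
    unfolding qs frobenius.simps by blast+
  have "strip_column xs = strip_column ys"
    using Cons.IH[of "strip_column ys"] fr Cons.prems partition_strip_column[of y ys] qs by blast
  with eq partition_eq_strip_column[of xs] partition_eq_strip_column[of ys]
  have "xs = ys" using Cons.hyps Cons.prems(1) unfolding qs partition_list_def
    by (metis list.set_intros(2) sorted_wrt.simps(2))
  with eq qs show ?case by simp
qed

text \<open>Induction from below: a hook with coordinates \<open>(a, b)\<close> is wrapped around
  the partition found for the smaller chain.\<close>

lemma frobenius_surj:
  assumes "finite S" and "strict_chain S" and "\<forall>x\<in>S. 1 \<le> fst x"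
  obtains ps where "partition_list ps" and "frobenius ps = S"
proof -
  have "\<exists>ps. partition_list ps \<and> frobenius ps = S" using assms
  proof (induction rule: strict_chain_induct)
    case empty
    then show ?case by (intro exI[of _ "[]"]) (simp add: partition_list_def)
  next
    case (insert a b S)
    then obtain ps where ps: "partition_list ps" "frobenius ps = S" by auto
    \<comment> \<open>A preimage of \<open>ps\<close> under \<open>strip_column\<close>: every row
      gains a box, and rows of length 1 fill up to \<open>b\<close> rows below the new first
      row.\<close>
    define xs where "xs = map Suc ps @ replicate (b - length ps) 1"
    \<comment> \<open>The outermost hook of \<open>ps\<close> is a point of \<open>S\<close>,
      strictly below \<open>(a, b)\<close>; so the padding length is not truncated and all rows fit
      under the new first row.\<close>
    have bd: "length ps \<le> b \<and> (\<forall>x\<in>set ps. x < a)"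
    proof (cases ps)
      case (Cons y ys)
      then have "(y, length ys) \<in> S" using ps by auto
      then have "y < a" "length ys < b" using insert.hyps by auto
      then show ?thesis using ps(1) Cons by (auto simp: partition_list_def)
    qed simp
    have 0: "0 \<notin> set ps" using ps(1) by (simp add: partition_list_def)
    have "filter (\<lambda>x. 1 < x) (map Suc ps) = map Suc ps"
      using 0 by (auto simp: filter_id_conv intro!: gr0I)
    then have strip: "strip_column xs = ps" unfolding xs_def by (simp add: strip_column_def o_def)
    have "length xs = b" using bd by (simp add: xs_def)
    moreover have "sorted_wrt (\<ge>) (replicate k (1::nat))" for k by (induction k) auto
    then have "partition_list (a # xs)"
      using ps(1) bd insert.prems unfolding partition_list_def xs_def
      by (auto simp: sorted_wrt_append sorted_wrt_map Suc_le_eq less_Suc_eq_le)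
    ultimately show ?case using ps strip by (intro exI[of _ "a # xs"]) simp
  qed
  then show thesis using that by blast
qed

section \<open>Hooks and Durfee squares of Young diagrams\<close>

lemma young_Nil: "young [] = {}" by (simp add: young_def)

lemma partition_nth: "partition_list ps \<Longrightarrow> r < length ps \<Longrightarrow> 0 < ps ! r"
  unfolding partition_list_def by (metis gr0I nth_mem)

lemma card_largest_hook:
  assumes "partition_list (x # xs)"
  shows "card (largest_hook (young (x # xs))) = x + length xs"
proof -
  have "0 < xs ! r" if "r < length xs" for r
    using partition_nth[OF assms, of "Suc r"] that by simp
  then have "largest_hook (young (x # xs)) = {0} \<times> {..<x} \<union> {1..length xs} \<times> {0}"
    unfolding largest_hook_def young_def by (auto simp: nth_Cons' split: if_splits)
  moreover have "card ({0::nat} \<times> {..<x} \<union> {1..length xs} \<times> {0::nat}) = x + length xs"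
    by (subst card_Un_disjoint) auto
  ultimately show ?thesis by simp
qed

text \<open>Rows of length 1 have no box beyond the first column, so only the rows kept by
  \<open>strip_column\<close> survive the shift.\<close>

lemma remove_hook_young:
  assumes "partition_list (x # xs)"
  shows "remove_hook (young (x # xs)) = young (strip_column xs)"
proof -
  define k where "k = length (strip_column xs)"
  have xs: "xs = map Suc (strip_column xs) @ replicate (length xs - k) 1"
    using partition_eq_strip_column[of xs] assms unfolding k_def partition_list_def by simp
  have k: "k \<le> length xs" unfolding k_def by (rule length_strip_column)
  have nth: "xs ! r = (if r < k then Suc (strip_column xs ! r) else 1)" if "r < length xs" for r
    using that k by (subst xs) (auto simp: nth_append k_def)
  show ?thesis
    unfolding remove_hook_def young_def using k
    by (auto simp: nth k_def[symmetric] split: if_splits)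
qed

text \<open>The missing box \<open>(d, d)\<close> excludes every larger square, which also bounds
  the set whose \<open>Max\<close> is taken.\<close>

lemma durfee_eqI:
  assumes "{..<d} \<times> {..<d} \<subseteq> Y" and "(d, d) \<notin> Y"
  shows "durfee Y = d"
  unfolding durfee_def
proof (rule Max_eqI)
  have bd: "e \<le> d" if "{..<e} \<times> {..<e} \<subseteq> Y" for e using that assms(2) by (auto simp: subset_iff not_less[symmetric])
  show "e \<le> d" if "e \<in> {d. {..<d} \<times> {..<d} \<subseteq> Y}" for e using that bd by blast
  show "finite {d. {..<d} \<times> {..<d} \<subseteq> Y}" using bd by (auto intro: finite_subset[of _ "{..d}"])
  show "d \<in> {d. {..<d} \<times> {..<d} \<subseteq> Y}" using assms(1) by blast
qed

text \<open>The Durfee square and the hook sizes are treated in one induction: an additional outer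
  hook enlarges the square by one and shifts the numbering of the removals by one.\<close>

lemma ex_durfee:
  assumes "partition_list ps"
  shows "\<exists>d. {..<d} \<times> {..<d} \<subseteq> young ps \<and> (d, d) \<notin> young ps \<and>
    (\<lambda>j. card (largest_hook ((remove_hook ^^ j) (young ps)))) ` {..<d}
      = (\<lambda>(a, b). a + b) ` frobenius ps"
  using assms
proof (induction rule: partition_induct)
  case Nil
  then show ?case by (simp add: young_Nil exI[of _ 0])
next
  case (Cons x xs)
  let ?Y = "young (x # xs)"
  from Cons.IH obtain d where d: "{..<d} \<times> {..<d} \<subseteq> young (strip_column xs)"
    "(d, d) \<notin> young (strip_column xs)"
    "(\<lambda>j. card (largest_hook ((remove_hook ^^ j) (young (strip_column xs))))) ` {..<d}
      = (\<lambda>(a, b). a + b) ` frobenius (strip_column xs)" by auto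
  have mono: "(r, c) \<in> ?Y" if "(r', c') \<in> ?Y" "r \<le> r'" "c \<le> c'" for r c r' c'
  proof -
    have "(x # xs) ! r' \<le> (x # xs) ! r" if "r' < length (x # xs)"
      using Cons.hyps \<open>r \<le> r'\<close> that unfolding partition_list_def
      by (cases "r = r'") (auto simp: sorted_wrt_iff_nth_less simp del: length_Cons)
    then show ?thesis using that unfolding young_def by auto
  qed
  have rm: "(r, c) \<in> young (strip_column xs) \<longleftrightarrow> (Suc r, Suc c) \<in> ?Y" for r c
    using remove_hook_young[OF Cons.hyps] unfolding remove_hook_def by auto
  have "0 < x" using partition_nth[OF Cons.hyps, of 0] by simp
  have "(r, c) \<in> ?Y" if "r < Suc d" "c < Suc d" for r c
  proof (cases d)
    case 0
    then show ?thesis using that \<open>0 < x\<close> by (simp add: young_def)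
  next
    \<comment> \<open>The last diagonal box of the inner square, moved back, is
      \<open>(d, d)\<close>; it forces the whole square of side \<open>Suc d\<close> into the
      diagram.\<close>
    case (Suc e)
    then have "(e, e) \<in> young (strip_column xs)" using d(1) by auto
    then show ?thesis using rm mono that Suc by (metis less_Suc_eq_le)
  qed
  then have "{..<Suc d} \<times> {..<Suc d} \<subseteq> ?Y" by auto
  moreover have "(Suc d, Suc d) \<notin> ?Y" using rm d(2) by blast
  moreover have "(\<lambda>j. card (largest_hook ((remove_hook ^^ j) ?Y))) ` {..<Suc d}
      = (\<lambda>(a, b). a + b) ` frobenius (x # xs)"
  proof -
    have "(remove_hook ^^ Suc j) ?Y = (remove_hook ^^ j) (young (strip_column xs))" for j
      by (simp add: funpow_Suc_right remove_hook_young[OF Cons.hyps] del: funpow.simps(2))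
    then show ?thesis using d(3) card_largest_hook[OF Cons.hyps]
      by (simp add: lessThan_Suc_eq_insert_0 image_image del: funpow.simps(2))
  qed
  ultimately show ?case by blast
qed

lemma hook_decomposition_eq:
  assumes "partition_list ps"
  shows "hook_decomposition ps = (\<lambda>(a, b). a + b) ` frobenius ps"
  using ex_durfee[OF assms] durfee_eqI unfolding hook_decomposition_def by blast

lemma sum_list_strip_column:
  "0 \<notin> set xs \<Longrightarrow> sum_list xs = sum_list (strip_column xs) + length xs"
  by (induction xs) (auto simp: strip_column_def)

text \<open>The hooks partition the diagram, so their sizes add up to its number of boxes.\<close>

lemma sum_list_eq_sum_frobenius:
  assumes "partition_list ps"
  shows "sum_list ps = (\<Sum>(a, b)\<in>frobenius ps. a + b)"
  using assms
proof (induction rule: partition_induct)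
  case (Cons x xs)
  have "(x, length xs) \<notin> frobenius (strip_column xs)"
    using frobenius_strip_column[OF Cons.hyps] by auto
  then show ?case using Cons finite_frobenius sum_list_strip_column[of xs]
    by (simp add: partition_list_def)
qed simp

text \<open>The outermost hook decides both sides: it carries the longest row and the number of
  rows. The leg counts only the rows below the first, which makes its bound strict.\<close>

lemma young_subset_box_iff:
  assumes "partition_list ps"
  shows "young ps \<subseteq> box n \<longleftrightarrow> frobenius ps \<subseteq> {1..(n + 1) div 2} \<times> {..<n div 2}"
proof (cases ps)
  case (Cons x xs)
  have x: "0 < x" and le: "\<forall>y\<in>set (x # xs). y \<le> x"
    using assms partition_nth[OF assms, of 0] Cons by (auto simp: partition_list_def)
  show ?thesis
  proof
    assume Y: "young ps \<subseteq> box n"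
    have "(length xs, 0) \<in> young ps" "(0, x - 1) \<in> young ps"
      using x partition_nth[OF assms, of "length xs"] by (auto simp: Cons young_def)
    then have "length ps \<le> n div 2" "x \<le> (n + 1) div 2" using Y Cons by (auto simp: box_def)
    then show "frobenius ps \<subseteq> {1..(n + 1) div 2} \<times> {..<n div 2}"
      using le Cons assms by (intro frobenius_bounded) auto
  next
    assume "frobenius ps \<subseteq> {1..(n + 1) div 2} \<times> {..<n div 2}"
    then have "x \<le> (n + 1) div 2" "length xs < n div 2" using Cons by auto
    moreover have "ps ! r \<le> x" if "r < length ps" for r using le that Cons nth_mem by blast
    ultimately show "young ps \<subseteq> box n" unfolding young_def box_def using Cons
      by (fastforce dest: order.strict_trans2)
  qed
qed (simp add: young_Nil)

lemma bij_betw_frobenius: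
  "bij_betw frobenius
    {ps. is_partition ps (\<Sum>D) \<and> hook_decomposition ps = D \<and> young ps \<subseteq> box n}
    {S. S \<subseteq> {1..(n + 1) div 2} \<times> {..<n div 2} \<and> strict_chain S \<and> (\<lambda>(a, b). a + b) ` S = D}"
    (is "bij_betw _ ?A ?B")
proof (rule bij_betw_imageI)
  have A: "?A = {ps. partition_list ps \<and> frobenius ps \<in> ?B}"
  proof -
    have "is_partition ps (\<Sum>D) \<longleftrightarrow> partition_list ps" if "partition_list ps \<Longrightarrow> (\<lambda>(a, b). a + b) ` frobenius ps = D" for ps
    proof -
      \<comment> \<open>Points of the chain have distinct sums, so summing over the hooks is summing
        over \<open>D\<close>.\<close>
      have "sum_list ps = \<Sum>D" if p: "partition_list ps"
        using \<open>partition_list ps \<Longrightarrow> _\<close>[OF p, symmetric] sum_list_eq_sum_frobenius[OF p]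
          strict_chain_inj_on_sum[OF strict_chain_frobenius[OF p]]
        by (simp add: sum.reindex)
      then show ?thesis unfolding is_partition_def partition_list_def by auto
    qed
    moreover have "is_partition ps m \<Longrightarrow> partition_list ps" for ps m
      unfolding is_partition_def partition_list_def by blast
    ultimately show ?thesis
      using hook_decomposition_eq young_subset_box_iff strict_chain_frobenius by blast
  qed
  show "inj_on frobenius ?A" unfolding A using frobenius_inj by (auto intro!: inj_onI)
  show "frobenius ` ?A = ?B"
  proof
    show "frobenius ` ?A \<subseteq> ?B" unfolding A by blast
    show "?B \<subseteq> frobenius ` ?A"
    proof
      fix S assume S: "S \<in> ?B"
      then have "finite S" by (auto intro: finite_subset)
      moreover have "\<forall>x\<in>S. 1 \<le> fst x" using S by auto
      ultimately obtain ps where "partition_list ps" "frobenius ps = S"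
        using frobenius_surj S by blast
      then show "S \<in> frobenius ` ?A" unfolding A using S by blast
    qed
  qed
qed

subsection \<open>321-avoiding involutions and Motzkin paths\<close>

definition openers :: "(nat \<Rightarrow> nat) \<Rightarrow> nat set" where
  "openers \<pi> = {i. i < \<pi> i}"

definition closers :: "(nat \<Rightarrow> nat) \<Rightarrow> nat set" where
  "closers \<pi> = {i. \<pi> i < i}"

text \<open>The elements of \<open>{1..n}\<close> outside \<open>C\<close> and \<open>E\<close> act as flat steps of a Motzkin path with
  up-steps \<open>E\<close> and down-steps \<open>C\<close>; flat steps occur at height 0 only.\<close>

definition ballot :: "nat \<Rightarrow> nat set \<Rightarrow> nat set \<Rightarrow> bool" where
  "ballot n E C \<longleftrightarrow> E \<subseteq> {1..n} \<and> C \<subseteq> {1..n} \<and> E \<inter> C = {} \<and> card E = card C \<and>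
     (\<forall>i. card (C \<inter> {..i}) \<le> card (E \<inter> {..i})) \<and>
     (\<forall>i\<in>{1..n} - (E \<union> C). card (C \<inter> {..i}) = card (E \<inter> {..i}))"

text \<open>This relates a path to the word \<open>U\<close> without saying how many flats turn up;
  the size of \<open>U\<close> will fix that number.\<close>

definition flats_split :: "nat \<Rightarrow> nat set \<Rightarrow> nat set \<Rightarrow> nat set \<Rightarrow> bool" where
  "flats_split n E C U \<longleftrightarrow> E \<subseteq> U \<and> C \<inter> U = {} \<and>
     (\<forall>i\<in>{1..n} - (E \<union> C) - U. \<forall>j\<in>({1..n} - (E \<union> C)) \<inter> U. i < j)"

lemma involutions_321_D:
  assumes "\<pi> \<in> involutions_321 n"
  shows involutions_321_permutes: "\<pi> permutes {1..n}"
    and involutions_321_invol: "\<pi> (\<pi> i) = i"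
    and openers_subset: "openers \<pi> \<subseteq> {1..n}"
    and closers_subset: "closers \<pi> \<subseteq> {1..n}"
proof -
  show p: "\<pi> permutes {1..n}" using assms by (simp add: involutions_321_def)
  show "\<pi> (\<pi> i) = i" using assms by (simp add: involutions_321_def fun_eq_iff)
  show "openers \<pi> \<subseteq> {1..n}" "closers \<pi> \<subseteq> {1..n}"
    using permutes_not_in[OF p] unfolding openers_def closers_def by force+
qed

text \<open>Positions outside \<open>{1..n}\<close> are fixed and take part in no inversion, so the
  pattern is excluded without range conditions.\<close>

lemma avoids_321D:
  assumes "\<pi> \<in> involutions_321 n" and "a < b" "b < c" "\<pi> b < \<pi> a" "\<pi> c < \<pi> b"
  shows False
proof -
  note p = involutions_321_permutes[OF assms(1)]
  have "a \<in> {1..n}"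
  proof (rule ccontr)
    assume a: "a \<notin> {1..n}"
    then have "\<pi> a = a" using permutes_not_in[OF p] by blast
    then have "\<pi> b < b" "\<pi> b < a" using assms by auto
    then have "b \<in> {1..n}" using permutes_not_in[OF p, of b] by force
    then have "\<pi> b \<in> {1..n}" using permutes_in_image[OF p] by blast
    with \<open>\<pi> b < a\<close> \<open>b \<in> {1..n}\<close> \<open>a < b\<close> a show False by auto
  qed
  moreover have "c \<in> {1..n}"
  proof (rule ccontr)
    assume c: "c \<notin> {1..n}"
    then have "\<pi> c = c" using permutes_not_in[OF p] by blast
    then have "b < \<pi> b" "c < \<pi> b" using assms by auto
    then have "b \<in> {1..n}" using permutes_not_in[OF p, of b] by force
    then have "\<pi> b \<in> {1..n}" using permutes_in_image[OF p] by blast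
    with \<open>c < \<pi> b\<close> \<open>b \<in> {1..n}\<close> \<open>b < c\<close> c show False by auto
  qed
  moreover have "b \<in> {1..n}" using \<open>a \<in> {1..n}\<close> \<open>c \<in> {1..n}\<close> assms(2,3) by auto
  ultimately show False using assms unfolding involutions_321_def avoids_321_def by blast
qed

text \<open>The arc and the fixed point would form the pattern at \<open>i\<close>,
  \<open>j\<close>, \<open>\<pi> i\<close>.\<close>

lemma no_fixed_point_under_arc:
  assumes "\<pi> \<in> involutions_321 n" and "i < j" "j < \<pi> i"
  shows "\<pi> j \<noteq> j"
proof
  assume "\<pi> j = j"
  then show False
    using avoids_321D[OF assms(1), of i j "\<pi> i"] involutions_321_invol[OF assms(1)] assms(2,3) by simp
qed

lemma no_fixed_point_under_arc':
  assumes "\<pi> \<in> involutions_321 n" and "\<pi> i < j" "j < i"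
  shows "\<pi> j \<noteq> j"
  using no_fixed_point_under_arc[OF assms(1), of "\<pi> i" j] assms involutions_321_invol[OF assms(1)] by simp

text \<open>Nested arcs starting at \<open>i < j\<close> give the pattern at \<open>i\<close>,
  \<open>j\<close>, \<open>\<pi> j\<close>.\<close>

lemma strict_mono_on_openers:
  assumes "\<pi> \<in> involutions_321 n"
  shows "strict_mono_on (openers \<pi>) \<pi>"
proof (rule strict_mono_onI, rule ccontr)
  fix i j assume ij: "i \<in> openers \<pi>" "j \<in> openers \<pi>" "i < j" "\<not> \<pi> i < \<pi> j"
  have "\<pi> i \<noteq> \<pi> j" using involutions_321_invol[OF assms] ij(3) by (metis less_irrefl)
  then show False
    using avoids_321D[OF assms, of i j "\<pi> j"] ij involutions_321_invol[OF assms]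
    by (simp add: openers_def)
qed

text \<open>Nested arcs again, now ending at \<open>i < j\<close>: the pattern sits at
  \<open>\<pi> j\<close>, \<open>\<pi> i\<close>, \<open>j\<close>.\<close>

lemma strict_mono_on_closers:
  assumes "\<pi> \<in> involutions_321 n"
  shows "strict_mono_on (closers \<pi>) \<pi>"
proof (rule strict_mono_onI, rule ccontr)
  fix i j assume ij: "i \<in> closers \<pi>" "j \<in> closers \<pi>" "i < j" "\<not> \<pi> i < \<pi> j"
  have "\<pi> i \<noteq> \<pi> j" using involutions_321_invol[OF assms] ij(3) by (metis less_irrefl)
  then show False
    using avoids_321D[OF assms, of "\<pi> j" "\<pi> i" j] avoids_321D[OF assms, of "\<pi> j" i j] ij involutions_321_invol[OF assms]
     avoids_321D[OF assms, of "\<pi> j" "\<pi> i" i]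
    by (simp add: closers_def)
qed

lemma bij_betw_openers_closers:
  assumes "\<pi> \<in> involutions_321 n"
  shows "bij_betw \<pi> (openers \<pi>) (closers \<pi>)"
  by (rule bij_betw_byWitness[where f' = \<pi>])
    (auto simp: openers_def closers_def involutions_321_invol[OF assms])

text \<open>Sending each closer to its opener embeds the closers of a prefix into its openers. At a
  fixed point no arc passes overhead, so there is an embedding in the other direction too.\<close>

lemma ballot_openers_closers:
  assumes "\<pi> \<in> involutions_321 n"
  shows "ballot n (openers \<pi>) (closers \<pi>)"
proof -
  note inv = involutions_321_invol[OF assms]
  have fin: "finite (openers \<pi> \<inter> {..i})" for i by simp
  have inj: "inj_on \<pi> A" for A by (rule inj_on_inverseI[where g = \<pi>]) (simp add: inv)
  have sub: "\<pi> ` (closers \<pi> \<inter> {..i}) \<subseteq> openers \<pi> \<inter> {..i}" for i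
    by (auto simp: openers_def closers_def inv)
  have "card (closers \<pi> \<inter> {..i}) \<le> card (openers \<pi> \<inter> {..i})" for i
    using card_inj_on_le[OF inj sub fin] .
  moreover have "card (closers \<pi> \<inter> {..i}) = card (openers \<pi> \<inter> {..i})"
    if "i \<in> {1..n} - (openers \<pi> \<union> closers \<pi>)" for i
  proof -
    have i: "\<pi> i = i" using that by (auto simp: openers_def closers_def)
    have "\<pi> j \<le> i" if "j \<in> openers \<pi>" "j \<le> i" for j
      using no_fixed_point_under_arc[OF assms, of j i] that i
      by (cases "j = i") (auto simp: openers_def not_le[symmetric])
    then have "\<pi> ` (openers \<pi> \<inter> {..i}) \<subseteq> closers \<pi> \<inter> {..i}"
      by (auto simp: openers_def closers_def inv)
    then have "card (openers \<pi> \<inter> {..i}) \<le> card (closers \<pi> \<inter> {..i})"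
      using card_inj_on_le[OF inj] by blast
    then show ?thesis using card_inj_on_le[OF inj sub fin] by (simp add: le_antisym)
  qed
  moreover have "openers \<pi> \<inter> closers \<pi> = {}" by (auto simp: openers_def closers_def)
  ultimately show ?thesis
    using openers_subset[OF assms] closers_subset[OF assms]
      bij_betw_same_card[OF bij_betw_openers_closers[OF assms]]
    unfolding ballot_def by blast
qed

section \<open>Matching openers with closers by rank\<close>

lemma card_below_strict_mono_image:
  fixes g :: "nat \<Rightarrow> nat"
  assumes "strict_mono_on A g" and "g ` A = B" and "x \<in> A"
  shows "card (B \<inter> {..g x}) = card (A \<inter> {..x})"
proof -
  have "g ` (A \<inter> {..x}) = B \<inter> {..g x}"
    using assms strict_mono_on_leD[OF assms(1)] strict_mono_on_less_eq[OF assms(1)] by auto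
  moreover have "inj_on g (A \<inter> {..x})"
    using strict_mono_on_imp_inj_on[OF assms(1)] inj_on_subset by blast
  ultimately show ?thesis by (metis card_image)
qed

lemma card_below_less:
  fixes B :: "nat set"
  assumes "y \<in> B" and "x < y"
  shows "card (B \<inter> {..x}) < card (B \<inter> {..y})"
proof (rule psubset_card_mono)
  have "y \<in> B \<inter> {..y}" "y \<notin> B \<inter> {..x}" "B \<inter> {..x} \<subseteq> B \<inter> {..y}" using assms by auto
  then show "B \<inter> {..x} \<subset> B \<inter> {..y}" by blast
qed simp

text \<open>As \<pi> increases on its openers, the k-th opener is matched with the k-th closer, so
  the two sets leave no choice.\<close>

lemma openers_closers_inj:
  assumes "\<pi> \<in> involutions_321 n" and "\<sigma> \<in> involutions_321 n"
    and O: "openers \<pi> = openers \<sigma>" and C: "closers \<pi> = closers \<sigma>"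
  shows "\<pi> = \<sigma>"
proof -
  have img: "\<tau> ` openers \<tau> = closers \<tau>" if "\<tau> \<in> involutions_321 n" for \<tau>
    using bij_betw_openers_closers[OF that] by (simp add: bij_betw_def)
  have op: "\<pi> i = \<sigma> i" if i: "i \<in> openers \<pi>" for i
  proof -
    have "card (closers \<pi> \<inter> {..\<pi> i}) = card (closers \<pi> \<inter> {..\<sigma> i})"
      using card_below_strict_mono_image[OF strict_mono_on_openers img, OF assms(1,1) i]
        card_below_strict_mono_image[OF strict_mono_on_openers img, OF assms(2,2)] i O C by simp
    moreover have "\<pi> i \<in> closers \<pi>" "\<sigma> i \<in> closers \<pi>" using img assms i O C by blast+
    ultimately show ?thesis using card_below_less by (metis less_irrefl linorder_neqE_nat)
  qed
  show ?thesis
  proof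
    fix i
    consider "i \<in> openers \<pi>" | "i \<in> closers \<pi>" | "\<pi> i = i"
      unfolding openers_def closers_def by force
    then show "\<pi> i = \<sigma> i"
    proof cases
      case 2
      then obtain j where "j \<in> openers \<pi>" "i = \<pi> j" using img[OF assms(1)] by blast
      then show ?thesis using op[of j] involutions_321_invol assms by metis
    next
      case 3
      then have "i \<notin> openers \<pi>" "i \<notin> closers \<pi>" by (auto simp: openers_def closers_def)
      then have "i \<notin> openers \<sigma>" "i \<notin> closers \<sigma>" using O C by blast+
      then show ?thesis using 3 by (simp add: openers_def closers_def)
    qed (rule op)
  qed
qed

text \<open>The k-th opener is matched with the k-th closer; the ballot conditions make the arcs
  point right and leave flats uncovered.\<close>

lemma ex_involution_of_ballot:
  assumes "ballot n E C"
  obtains \<pi> where "\<pi> \<in> involutions_321 n" and "openers \<pi> = E" and "closers \<pi> = C"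
proof -
  have sub: "E \<subseteq> {1..n}" "C \<subseteq> {1..n}" and disj: "E \<inter> C = {}" and card: "card E = card C"
    and le: "\<And>i. card (C \<inter> {..i}) \<le> card (E \<inter> {..i})"
    and eq: "\<And>i. i \<in> {1..n} - (E \<union> C) \<Longrightarrow> card (C \<inter> {..i}) = card (E \<inter> {..i})"
    using assms unfolding ballot_def by blast+
  have fin: "finite E" "finite C" using sub finite_subset by blast+
  obtain e where e: "bij_betw e {..<card E} E" "strict_mono_on {..<card E} e"
    using ex_bij_betw_strict_mono_card[OF fin(1)] .
  obtain c where c: "bij_betw c {..<card C} C" "strict_mono_on {..<card C} c"
    using ex_bij_betw_strict_mono_card[OF fin(2)] .
  \<comment> \<open>\<open>e\<close> and \<open>c\<close> list openers and closers increasingly, so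
    \<open>g\<close> is the matching by rank.\<close>
  define g where "g = c \<circ> the_inv_into {..<card E} e"
  define h where "h = the_inv_into E g"
  have ge: "g (e k) = c k" if "k < card E" for k
    using that e(1) by (simp add: g_def the_inv_into_f_f bij_betw_def)
  have E: "E = e ` {..<card E}" using e(1) by (simp add: bij_betw_def)
  have g_mono: "strict_mono_on E g"
  proof (rule strict_mono_onI)
    fix x y assume "x \<in> E" "y \<in> E" "x < y"
    then obtain k l where kl: "k < card E" "l < card E" "x = e k" "y = e l" using E by blast
    then have "k < l" using \<open>x < y\<close> strict_mono_on_less[OF e(2)] by simp
    then show "g x < g y" using kl ge card strict_mono_onD[OF c(2), of k l] by simp
  qed
  have bij: "bij_betw g E C"
    unfolding g_def using bij_betw_trans[OF bij_betw_the_inv_into[OF e(1)]] c(1) card by metis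
  then have img: "g ` E = C" and inj: "inj_on g E" by (auto simp: bij_betw_def)
  have hg: "h (g x) = x" if "x \<in> E" for x using that inj by (simp add: h_def the_inv_into_f_f)
  have gh: "g (h y) = y" "h y \<in> E" if "y \<in> C" for y using that img hg by auto
  have rank: "card (C \<inter> {..g x}) = card (E \<inter> {..x})" if "x \<in> E" for x
    using card_below_strict_mono_image[OF g_mono img that] .
  \<comment> \<open>Otherwise the prefix ending at \<open>g x\<close> has as many closers as the
    rank of \<open>x\<close>, but fewer openers.\<close>
  have g_gt: "x < g x" if x: "x \<in> E" for x
  proof (rule ccontr)
    assume "\<not> x < g x"
    moreover have "g x \<noteq> x" using x img disj by (metis disjoint_iff image_eqI)
    ultimately have "card (E \<inter> {..g x}) < card (E \<inter> {..x})" using x by (intro card_below_less) auto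
    then show False using le[of "g x"] rank[OF x] by simp
  qed
  \<comment> \<open>A flat under the arc would lie at height 0, yet its prefix contains the opener
    \<open>x\<close> and only closers of smaller rank.\<close>
  have arc: "j \<in> E \<union> C" if "x \<in> E" "x < j" "j < g x" for x j
  proof (rule ccontr)
    assume "j \<notin> E \<union> C"
    moreover have "g x \<in> {1..n}" "x \<in> {1..n}" using that(1) img sub by auto
    ultimately have "card (C \<inter> {..j}) = card (E \<inter> {..j})" using eq[of j] that by auto
    moreover have "card (C \<inter> {..j}) < card (C \<inter> {..g x})" using that img by (intro card_below_less) auto
    moreover have "card (E \<inter> {..x}) \<le> card (E \<inter> {..j})" using that by (intro card_mono) auto
    ultimately show False using rank[OF that(1)] by simp
  qed
  define \<pi> where "\<pi> i = (if i \<in> E then g i else if i \<in> C then h i else i)" for i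
  have \<pi>E: "\<pi> i = g i" if "i \<in> E" for i using that by (simp add: \<pi>_def)
  have \<pi>C: "\<pi> i = h i" if "i \<in> C" for i using that disj by (auto simp: \<pi>_def)
  have \<pi>F: "\<pi> i = i" if "i \<notin> E \<union> C" for i using that by (simp add: \<pi>_def)
  have lt_h: "h y < y" if "y \<in> C" for y using g_gt[of "h y"] gh[OF that] by simp
  have inv: "\<pi> (\<pi> i) = i" for i
    by (cases "i \<in> E"; cases "i \<in> C") (use img disj hg gh in \<open>auto simp: \<pi>E \<pi>C \<pi>F\<close>)
  have h_mono: "h x < h y" if "x \<in> C" "y \<in> C" "x < y" for x y
    using that gh strict_mono_on_less[OF g_mono] by metis
  have opn: "openers \<pi> = E" and cls: "closers \<pi> = C"
    using g_gt lt_h disj unfolding openers_def closers_def \<pi>_def by (auto split: if_splits dest: order.asym)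
  have "\<pi> permutes {1..n}"
    unfolding permutes_def using sub inv \<pi>F by (metis UnE subsetD)
  moreover have "avoids_321 n \<pi>"
    unfolding avoids_321_def
  proof (clarify)
    fix a b c assume abc: "a < b" "b < c" "\<pi> b < \<pi> a" "\<pi> c < \<pi> b"
    \<comment> \<open>The middle of the pattern is no opener: an earlier opener has a smaller image,
      and any other earlier position does not move right.\<close>
    have b: "b \<notin> E"
    proof
      assume "b \<in> E"
      consider "a \<in> E" | "a \<notin> E" by blast
      then show False
      proof cases
        case 1
        then show False using strict_mono_onD[OF g_mono 1 \<open>b \<in> E\<close>] abc \<pi>E \<open>b \<in> E\<close> by simp
      next
        case 2
        then have "\<pi> a \<le> a" using opn by (auto simp: openers_def)
        then show False using abc g_gt[OF \<open>b \<in> E\<close>] \<pi>E[OF \<open>b \<in> E\<close>] by simp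
      qed
    qed
    show False
    proof (cases "b \<in> C")
      case True
      consider "c \<in> C" | "c \<notin> C" by blast
      then show False
      proof cases
        case 1
        then show False using h_mono[OF True 1] abc \<pi>C True by simp
      next
        case 2
        then have "c \<le> \<pi> c" using cls by (auto simp: closers_def)
        then show False using abc lt_h[OF True] \<pi>C[OF True] by simp
      qed
    next
      case False
      \<comment> \<open>A fixed middle point would lie under the arc starting at
        \<open>a\<close>.\<close>
      then have "b < \<pi> a" using abc b \<pi>F by auto
      then have "a \<in> E" using abc opn by (auto simp: openers_def)
      then show False using arc[of a b] \<open>b < \<pi> a\<close> abc b False \<pi>E by auto
    qed
  qed
  ultimately have "\<pi> \<in> involutions_321 n" unfolding involutions_321_def using inv by auto
  then show thesis using that opn cls by blast
qed

subsection \<open>Motzkin paths and words\<close>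

text \<open>These are the \<open>t\<close> largest elements, collected by adding the largest
  remaining one.\<close>

lemma ex_upper_set_of_card:
  fixes F :: "nat set"
  assumes "finite F" and "t \<le> card F"
  obtains G where "G \<subseteq> F" and "card G = t" and "\<forall>i\<in>F - G. \<forall>j\<in>G. i < j"
proof -
  have "\<exists>G\<subseteq>F. card G = t \<and> (\<forall>i\<in>F - G. \<forall>j\<in>G. i < j)" using assms(2)
  proof (induction t)
    case 0
    then show ?case by (intro exI[of _ "{}"]) simp
  next
    case (Suc t)
    then obtain G where G: "G \<subseteq> F" "card G = t" "\<forall>i\<in>F - G. \<forall>j\<in>G. i < j" by auto
    let ?x = "Max (F - G)"
    have "F - G \<noteq> {}" using G Suc.prems by auto
    then have x: "?x \<in> F - G" using assms(1) by (intro Max_in) auto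
    have "i < ?x" if "i \<in> F - insert ?x G" for i
      using that assms(1) Max_ge[of "F - G" i] by (auto simp: le_less)
    then show ?case using G x assms(1) finite_subset[OF G(1)]
      by (intro exI[of _ "insert ?x G"]) auto
  qed
  then show thesis using that by blast
qed

text \<open>Upper sets are comparable by inclusion: otherwise an element lying only in one and an
  element lying only in the other would each be smaller than the other.\<close>

lemma upper_sets_of_equal_card:
  fixes F :: "nat set"
  assumes "finite F" "G \<subseteq> F" "H \<subseteq> F" "card G = card H"
    and G: "\<forall>i\<in>F - G. \<forall>j\<in>G. i < j" and H: "\<forall>i\<in>F - H. \<forall>j\<in>H. i < j"
  shows "G = H"
proof -
  have "finite G" "finite H" using assms finite_subset by blast+
  have "G \<subseteq> H \<or> H \<subseteq> G"
  proof (rule ccontr)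
    assume "\<not> (G \<subseteq> H \<or> H \<subseteq> G)"
    then obtain x y where "x \<in> G - H" "y \<in> H - G" by blast
    then have "x < y" "y < x" using G H assms(2,3) by blast+
    then show False by simp
  qed
  then show ?thesis using assms(4) \<open>finite G\<close> \<open>finite H\<close> card_subset_eq by metis
qed

lemma ballotD:
  assumes "ballot n E C"
  shows "E \<subseteq> {1..n}" and "C \<subseteq> {1..n}" and "E \<inter> C = {}" and "card E = card C"
    and "card (C \<inter> {..i}) \<le> card (E \<inter> {..i})"
    and "i \<in> {1..n} - (E \<union> C) \<Longrightarrow> card (C \<inter> {..i}) = card (E \<inter> {..i})"
  using assms unfolding ballot_def by blast+

lemma card_flats:
  assumes "ballot n E C"
  shows "n = 2 * card E + card ({1..n} - (E \<union> C))"
proof -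
  note b = ballotD[OF assms]
  have "finite E" "finite C" using b(1,2) finite_subset by blast+
  then have "card ({1..n} - (E \<union> C)) = n - 2 * card E"
    using b(1-4) by (subst card_Diff_subset) (auto simp: card_Un_disjoint)
  moreover have "2 * card E \<le> n"
    using card_mono[of "{1..n}" "E \<union> C"] b(1-4) \<open>finite E\<close> \<open>finite C\<close> by (simp add: card_Un_disjoint)
  ultimately show ?thesis by simp
qed

lemma card_word:
  assumes "ballot n E C" and "flats_split n E C U" and "U \<subseteq> {1..n}"
  shows "card U = card E + card (({1..n} - (E \<union> C)) \<inter> U)"
proof -
  let ?G = "({1..n} - (E \<union> C)) \<inter> U"
  have "U = E \<union> ?G" using assms(2,3) unfolding flats_split_def by blast
  then have "card U = card (E \<union> ?G)" by (rule arg_cong)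
  also have "\<dots> = card E + card ?G"
    using finite_subset[OF ballotD(1)[OF assms(1)]] by (intro card_Un_disjoint) auto
  finally show ?thesis .
qed

text \<open>The number of flats has the parity of \<open>n\<close>, so the prescribed size of
  \<open>U\<close> means that half of the flats, rounded up, turn up; they must be the last
  ones.\<close>

lemma ex1_word_of_ballot:
  assumes "ballot n E C"
  shows "\<exists>!U. U \<subseteq> {1..n} \<and> card U = (n + 1) div 2 \<and> flats_split n E C U"
proof -
  note b = ballotD[OF assms]
  define F where "F = {1..n} - (E \<union> C)"
  have fin: "finite E" "finite F" using b(1) finite_subset unfolding F_def by blast+
  have disj: "E \<inter> F = {}" "C \<inter> F = {}" by (auto simp: F_def)
  have n: "n = 2 * card E + card F" using card_flats[OF assms] by (simp add: F_def)
  have "(card F + 1) div 2 \<le> card F" by presburger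
  then obtain G where G: "G \<subseteq> F" "card G = (card F + 1) div 2" "\<forall>i\<in>F - G. \<forall>j\<in>G. i < j"
    using ex_upper_set_of_card[OF fin(2)] by blast
  have split: "flats_split n E C U \<longleftrightarrow>
      E \<subseteq> U \<and> C \<inter> U = {} \<and> (\<forall>i\<in>F - F \<inter> U. \<forall>j\<in>F \<inter> U. i < j)" for U
    unfolding flats_split_def F_def by blast
  have decomp: "U = E \<union> F \<inter> U" if "U \<subseteq> {1..n}" "flats_split n E C U" for U
    using that unfolding flats_split_def F_def by blast
  have card: "card (E \<union> H) = (n + 1) div 2 \<longleftrightarrow> card H = card G" if "H \<subseteq> F" for H
    using that disj fin n G(2) finite_subset[OF that fin(2)] by (subst card_Un_disjoint) auto
  show ?thesis
  proof (rule ex1I[of _ "E \<union> G"])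
    have "F \<inter> (E \<union> G) = G" using disj G(1) by blast
    moreover have "C \<inter> (E \<union> G) = {}" using disj G(1) b(3) by blast
    moreover have "E \<union> G \<subseteq> {1..n}" using G(1) b(1) F_def by blast
    ultimately show "E \<union> G \<subseteq> {1..n} \<and> card (E \<union> G) = (n + 1) div 2 \<and> flats_split n E C (E \<union> G)"
      using G(3) card[OF G(1)] unfolding split by auto
  next
    fix U assume U: "U \<subseteq> {1..n} \<and> card U = (n + 1) div 2 \<and> flats_split n E C U"
    then have "card (F \<inter> U) = card G" using card[of "F \<inter> U"] decomp[of U] by simp
    then have "F \<inter> U = G"
      using upper_sets_of_equal_card[OF fin(2) _ G(1)] G(3) U unfolding split by blast
    then show "U = E \<union> G" using decomp U by blast
  qed
qed

text \<open>Appending a down-step to a word pairs it with the last up-step that is still flat, if any.\<close>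

lemma ex_ballot_of_word:
  assumes "U \<subseteq> {1..n}"
  shows "\<exists>E C. ballot n E C \<and> flats_split n E C U"
  using assms
proof (induction n arbitrary: U)
  case 0
  then show ?case by (intro exI[of _ "{}"]) (simp add: ballot_def flats_split_def)
next
  case (Suc n)
  define V where "V = U - {Suc n}"
  have V: "V \<subseteq> {1..n}" using Suc.prems by (auto simp: V_def le_Suc_eq)
  obtain E C where b: "ballot n E C" and s: "flats_split n E C V" using Suc.IH[OF V] by blast
  note bD = ballotD[OF b]
  have fin: "finite E" "finite C" using bD(1,2) finite_subset by blast+
  have all: "E \<inter> {..i} = E" "C \<inter> {..i} = C" if "n \<le> i" for i using bD(1,2) that by fastforce+
  define F where "F = {1..n} - (E \<union> C)"
  have new: "Suc n \<notin> E \<union> C" using bD(1,2) by auto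
  then have F: "{1..Suc n} - (E \<union> C) = insert (Suc n) F" by (auto simp: F_def le_Suc_eq)
  have sV: "E \<subseteq> V" "C \<inter> V = {}" and lt: "\<And>i j. i \<in> F - V \<Longrightarrow> j \<in> F \<inter> V \<Longrightarrow> i < j"
    using s unfolding flats_split_def F_def by blast+
  have UV: "i \<in> U \<longleftrightarrow> i \<in> V" if "i \<noteq> Suc n" for i using that by (simp add: V_def)
  have bound: "i \<le> n" if "i \<in> F" for i using that by (simp add: F_def)
  show ?case
  proof (cases "Suc n \<notin> U \<and> F \<inter> V \<noteq> {}")
    case False
    \<comment> \<open>The new position becomes a flat at height 0. If it is a down-step, then all
      earlier flats are down-steps too, so their order is kept.\<close>
    have "ballot (Suc n) E C"
      unfolding ballot_def F
    proof (intro conjI allI ballI)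
      fix i assume "i \<in> insert (Suc n) F"
      then show "card (C \<inter> {..i}) = card (E \<inter> {..i})"
        using bD(4) bD(6)[of i] all[of i] by (cases "i = Suc n") (auto simp: F_def)
    qed (use bD in \<open>auto simp: le_Suc_eq\<close>)
    moreover have "flats_split (Suc n) E C U"
      unfolding flats_split_def F
    proof (intro conjI ballI)
      fix i j assume i: "i \<in> insert (Suc n) F - U" and j: "j \<in> insert (Suc n) F \<inter> U"
      show "i < j"
      proof (cases "Suc n \<in> U")
        case True
        then have "i \<in> F - V" using i UV[of i] by auto
        then show ?thesis using j lt[of i j] bound[of i] UV[of j] by (cases "j = Suc n") auto
      next
        case False': False
        then show ?thesis using j False UV[of j] by auto
      qed
    qed (use sV new in \<open>auto simp: V_def\<close>)
    ultimately show ?thesis by blast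
  next
    case True
    define u where "u = Max (F \<inter> V)"
    have finF: "finite (F \<inter> V)" by (simp add: F_def)
    have u: "u \<in> F" "u \<in> V" using Max_in[OF finF] True by (auto simp: u_def)
    have u_max: "i \<le> u" if "i \<in> F \<inter> V" for i using Max_ge[OF finF that] by (simp add: u_def)
    \<comment> \<open>\<open>u\<close> is the last flat of all: up-flats do not exceed it and
      down-flats precede it. So turning it into an opener raises no other flat.\<close>
    have F_le: "i < u" if "i \<in> F - {u}" for i
      using that u_max[of i] lt[of i u] u by (cases "i \<in> V") auto
    have u': "u \<notin> E" "u \<notin> C" "1 \<le> u" "u \<le> n" using u by (auto simp: F_def)
    have F': "{1..Suc n} - (insert u E \<union> insert (Suc n) C) = F - {u}" by (auto simp: F_def le_Suc_eq)
    have cE: "card (insert u E \<inter> {..i}) = card (E \<inter> {..i}) + (if u \<le> i then 1 else 0)" for i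
      using u' fin by auto
    have cC: "card (insert (Suc n) C \<inter> {..i}) = card (C \<inter> {..i}) + (if Suc n \<le> i then 1 else 0)" for i
      using new fin by auto
    have "ballot (Suc n) (insert u E) (insert (Suc n) C)"
      unfolding ballot_def F'
    proof (intro conjI allI ballI)
      fix i
      show "card (insert (Suc n) C \<inter> {..i}) \<le> card (insert u E \<inter> {..i})"
        unfolding cE cC using bD(5)[of i] u' by auto
    next
      fix i assume i: "i \<in> F - {u}"
      then have "card (C \<inter> {..i}) = card (E \<inter> {..i})" using bD(6)[of i] by (simp add: F_def)
      then show "card (insert (Suc n) C \<inter> {..i}) = card (insert u E \<inter> {..i})"
        unfolding cE cC using F_le[OF i] u' by auto
    qed (use bD u' new fin in auto)
    moreover have "flats_split (Suc n) (insert u E) (insert (Suc n) C) U"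
      unfolding flats_split_def F'
    proof (intro conjI ballI)
      fix i j assume "i \<in> F - {u} - U" and "j \<in> (F - {u}) \<inter> U"
      then show "i < j" using lt[of i j] bound[of i] bound[of j] UV[of i] UV[of j] by auto
    qed (use sV u True new in \<open>auto simp: V_def\<close>)
    ultimately show ?thesis by blast
  qed
qed

section \<open>Uniqueness of the Motzkin path of a word\<close>

lemma card_Int_atMost_split:
  fixes A :: "nat set"
  assumes "finite A"
  shows "card A = card (A \<inter> {..i}) + card (A \<inter> {i<..})"
proof -
  have "A - {..i} = A \<inter> {i<..}" by auto
  then show ?thesis using card_Int_Diff[OF assms, of "{..i}"] by simp
qed

text \<open>At the first position where two decompositions differ the prefixes have the same height,
  so one of them is flat there and the other one leaves height 0 and must go up.\<close>

lemma first_difference_not_closer: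
  assumes "ballot n E C" and "ballot n E' C'"
    and E: "E \<inter> {..i} = E' \<inter> {..i}" and C: "C \<inter> {..<i} = C' \<inter> {..<i}"
    and "i \<in> C" and "i \<notin> C'"
  shows False
proof -
  have "i \<in> {1..n} - (E' \<union> C')"
    using ballotD(2,3)[OF assms(1)] assms(5,6) E by blast
  then have eq: "card (C' \<inter> {..i}) = card (E' \<inter> {..i})" by (rule ballotD(6)[OF assms(2)])
  have "C \<inter> {..i} = insert i (C \<inter> {..<i})" "C' \<inter> {..i} = C' \<inter> {..<i}"
    using assms(5,6) by (auto simp: le_less)
  then have "card (C \<inter> {..i}) = Suc (card (C' \<inter> {..i}))" using C by simp
  then show False using ballotD(5)[OF assms(1), of i] eq E by simp
qed

text \<open>Seen from the right: equal suffixes and total balance carry the height 0 of the flat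
  over to the other path, which would be at height 0 after an up-step and hence below 0 before
  it.\<close>

lemma last_difference_not_opener:
  assumes "ballot n E C" and "ballot n E' C'"
    and E: "E \<inter> {i<..} = E' \<inter> {i<..}" and C: "C \<inter> {i..} = C' \<inter> {i..}"
    and "i \<in> E" and "i \<notin> E'"
  shows False
proof -
  have fin: "finite E" "finite C" "finite E'" "finite C'"
    using ballotD(1,2)[OF assms(1)] ballotD(1,2)[OF assms(2)] finite_subset[OF _ finite_atLeastAtMost]
    by blast+
  have sub: "i \<in> {i..}" "{i<..} \<subseteq> {i..}" by auto
  then have "i \<in> C' \<longleftrightarrow> i \<in> C" using C by blast
  then have i: "i \<notin> C" "i \<notin> C'" "i \<in> {1..n} - (E' \<union> C')"
    using ballotD(1,3)[OF assms(1)] assms(5,6) by blast+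
  have CC: "C \<inter> {i<..} = C' \<inter> {i<..}" using C sub(2) by blast
  have "card (E' \<inter> {i<..}) = card (C' \<inter> {i<..})"
    using ballotD(4)[OF assms(2)] ballotD(6)[OF assms(2) i(3)]
      card_Int_atMost_split[OF fin(3), of i] card_Int_atMost_split[OF fin(4), of i] by simp
  then have "card (E \<inter> {..i}) = card (C \<inter> {..i})"
    using E CC ballotD(4)[OF assms(1)]
      card_Int_atMost_split[OF fin(1), of i] card_Int_atMost_split[OF fin(2), of i] by simp
  moreover obtain k where k: "i = Suc k" using i(3) by (cases i) auto
  then have "E \<inter> {..i} = insert i (E \<inter> {..k})" "C \<inter> {..i} = C \<inter> {..k}"
    using assms(5) i(1) by (auto simp: atMost_Suc)
  ultimately show False using ballotD(5)[OF assms(1), of k] k by simp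
qed

text \<open>Down-flats of the second path precede \<open>i\<close>, so they are down-flats of the
  first, which has \<open>j\<close> in addition. Up-flats of the first follow \<open>j\<close>, so
  they are up-flats of the second, which has \<open>i\<close> in addition. But the word fixes the
  difference of the numbers of up-flats and down-flats.\<close>

lemma first_opener_last_closer_contradiction:
  assumes b: "ballot n E C" and b': "ballot n E' C'"
    and s: "flats_split n E C U" and s': "flats_split n E' C' U" and U: "U \<subseteq> {1..n}"
    and i: "i \<in> U" "i \<in> E" "i \<notin> E'" and j: "j \<in> {1..n} - U" "j \<in> C \<longleftrightarrow> j \<notin> C'"
    and same: "\<And>l. l < i \<or> j < l \<Longrightarrow> (l \<in> E \<longleftrightarrow> l \<in> E') \<and> (l \<in> C \<longleftrightarrow> l \<in> C')"
    and "i < j"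
  shows False
proof -
  define F F' where "F = {1..n} - (E \<union> C)" and "F' = {1..n} - (E' \<union> C')"
  have fin: "finite F" "finite F'" by (simp_all add: F_def F'_def)
  have sub: "E \<subseteq> U" "C \<inter> U = {}" "E' \<subseteq> U" "C' \<inter> U = {}"
    and lt: "\<And>x y. x \<in> F - U \<Longrightarrow> y \<in> F \<inter> U \<Longrightarrow> x < y" "\<And>x y. x \<in> F' - U \<Longrightarrow> y \<in> F' \<inter> U \<Longrightarrow> x < y"
    using s s' unfolding flats_split_def F_def F'_def by blast+
  have iF: "i \<in> F' \<inter> U" "i \<notin> F" using i sub U by (auto simp: F_def F'_def)
  have lo: "x \<in> F - U" if "x \<in> F' - U" for x
    using lt(2)[OF that iF(1)] same[of x] that by (auto simp: F_def F'_def)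
  have "j \<notin> F'" using lt(2)[of j i] iF j(1) \<open>i < j\<close> by auto
  then have "j \<in> F - U" using j sub by (auto simp: F_def F'_def)
  then have "F' - U \<subset> F - U" using lo \<open>j \<notin> F'\<close> by blast
  then have 1: "card (F' - U) < card (F - U)" using fin by (intro psubset_card_mono) auto
  have "x \<in> F' \<inter> U" if "x \<in> F \<inter> U" for x
    using lt(1)[OF \<open>j \<in> F - U\<close> that] same[of x] that by (auto simp: F_def F'_def)
  then have "F \<inter> U \<subset> F' \<inter> U" using iF by blast
  then have 2: "card (F \<inter> U) < card (F' \<inter> U)" using fin by (intro psubset_card_mono) auto
  have "card E + card (F \<inter> U) = card E' + card (F' \<inter> U)"
    using card_word[OF b s U] card_word[OF b' s' U] by (simp add: F_def F'_def)
  moreover have "2 * card E + (card (F \<inter> U) + card (F - U)) = 2 * card E' + (card (F' \<inter> U) + card (F' - U))"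
  proof -
    have "card (F \<inter> U) + card (F - U) = card F" "card (F' \<inter> U) + card (F' - U) = card F'"
      using fin by (metis card_Int_Diff)+
    then show ?thesis using card_flats[OF b] card_flats[OF b'] by (simp add: F_def F'_def)
  qed
  ultimately show False using 1 2 by linarith
qed

text \<open>The first position where the paths differ must be an up-step of the word and the last
  one a down-step; together these are contradictory, whichever path has the opener.\<close>

lemma ballot_of_word_unique:
  assumes b: "ballot n E C" and b': "ballot n E' C'"
    and s: "flats_split n E C U" and s': "flats_split n E' C' U" and U: "U \<subseteq> {1..n}"
  shows "E = E' \<and> C = C'"
proof (rule ccontr)
  assume ne: "\<not> (E = E' \<and> C = C')"
  define \<Delta> where "\<Delta> = {l. (l \<in> E \<longleftrightarrow> l \<notin> E') \<or> (l \<in> C \<longleftrightarrow> l \<notin> C')}"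
  have sub: "\<Delta> \<subseteq> {1..n}" using ballotD(1,2)[OF b] ballotD(1,2)[OF b'] by (auto simp: \<Delta>_def)
  have fin: "finite \<Delta>" using sub finite_subset by blast
  have "\<Delta> \<noteq> {}" using ne by (auto simp: \<Delta>_def)
  define i j where "i = Min \<Delta>" and "j = Max \<Delta>"
  have ij: "i \<in> \<Delta>" "j \<in> \<Delta>" "i \<le> j" using fin \<open>\<Delta> \<noteq> {}\<close> by (auto simp: i_def j_def)
  have out: "l \<notin> \<Delta>" if "l < i \<or> j < l" for l
    using that Min_le[OF fin, of l] Max_ge[OF fin, of l] by (auto simp: i_def j_def)
  have same: "(l \<in> E \<longleftrightarrow> l \<in> E') \<and> (l \<in> C \<longleftrightarrow> l \<in> C')" if "l < i \<or> j < l" for l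
    using out[OF that] by (auto simp: \<Delta>_def)
  have EU: "E \<subseteq> U" "C \<inter> U = {}" "E' \<subseteq> U" "C' \<inter> U = {}"
    using s s' unfolding flats_split_def by blast+
  have "i \<in> U"
  proof (rule ccontr)
    assume "i \<notin> U"
    then have "i \<notin> E" "i \<notin> E'" and Ci: "i \<in> C \<longleftrightarrow> i \<notin> C'" using EU ij(1) by (auto simp: \<Delta>_def)
    then have E: "E \<inter> {..i} = E' \<inter> {..i}" and C: "C \<inter> {..<i} = C' \<inter> {..<i}"
      using same by (auto simp: le_less)
    show False
      using first_difference_not_closer[OF b b' E C] first_difference_not_closer[OF b' b E[symmetric] C[symmetric]]
        Ci by blast
  qed
  have "j \<notin> U"
  proof
    assume "j \<in> U"
    then have "j \<notin> C" "j \<notin> C'" and Ej: "j \<in> E \<longleftrightarrow> j \<notin> E'" using EU ij(2) by (auto simp: \<Delta>_def)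
    then have E: "E \<inter> {j<..} = E' \<inter> {j<..}" and C: "C \<inter> {j..} = C' \<inter> {j..}"
      using same by (auto simp: le_less)
    show False
      using last_difference_not_opener[OF b b' E C] last_difference_not_opener[OF b' b E[symmetric] C[symmetric]]
        Ej by blast
  qed
  have "i < j" using \<open>i \<in> U\<close> \<open>j \<notin> U\<close> ij(3) by (metis le_neq_implies_less)
  have Ei: "i \<in> E \<longleftrightarrow> i \<notin> E'" using \<open>i \<in> U\<close> ij(1) EU by (auto simp: \<Delta>_def)
  have Cj: "j \<in> C \<longleftrightarrow> j \<notin> C'" using \<open>j \<notin> U\<close> ij(2) EU by (auto simp: \<Delta>_def)
  have jn: "j \<in> {1..n} - U" using \<open>j \<notin> U\<close> ij(2) sub by blast
  show False
  proof (cases "i \<in> E")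
    case True
    show ?thesis
      using first_opener_last_closer_contradiction[OF b b' s s' U \<open>i \<in> U\<close> True _ jn Cj same \<open>i < j\<close>] Ei True
      by blast
  next
    case False
    then show ?thesis
      using first_opener_last_closer_contradiction[OF b' b s' s U \<open>i \<in> U\<close> _ False jn _ _ \<open>i < j\<close>] Ei Cj same
      by blast
  qed
qed

subsection \<open>Peaks\<close>

definition peaks :: "nat \<Rightarrow> nat set \<Rightarrow> nat set" where
  "peaks n U = {i. 1 \<le> i \<and> i < n \<and> i \<in> U \<and> Suc i \<notin> U}"

text \<open>At a peak, \<open>i\<close> does not move left, \<open>Suc i\<close> does not move
  right, and not both are fixed, since down-flats precede up-flats. A descent elsewhere would yield
  a fixed point under an arc, or two openers or two closers out of order.\<close>

lemma descents_eq_peaks: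
  assumes \<pi>: "\<pi> \<in> involutions_321 n" and U: "U \<subseteq> {1..n}"
    and s: "flats_split n (openers \<pi>) (closers \<pi>) U"
  shows "descents n \<pi> = peaks n U"
proof -
  have EU: "openers \<pi> \<subseteq> U" "closers \<pi> \<inter> U = {}"
    using s unfolding flats_split_def by blast+
  have lt: "i < j" if "i \<in> {1..n}" "\<pi> i = i" "i \<notin> U" "\<pi> j = j" "j \<in> U" for i j
  proof -
    let ?F = "{1..n} - (openers \<pi> \<union> closers \<pi>)"
    have "i \<in> ?F - U" "j \<in> ?F \<inter> U" using that U by (auto simp: openers_def closers_def)
    then show ?thesis using s unfolding flats_split_def by blast
  qed
  have "\<pi> (Suc i) < \<pi> i \<longleftrightarrow> i \<in> U \<and> Suc i \<notin> U" if i: "1 \<le> i" "i < n" for i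
  proof
    assume "i \<in> U \<and> Suc i \<notin> U"
    then have "i \<notin> closers \<pi>" "Suc i \<notin> openers \<pi>" "\<not> (\<pi> i = i \<and> \<pi> (Suc i) = Suc i)"
      using EU lt[of "Suc i" i] i \<open>i \<in> U \<and> Suc i \<notin> U\<close> by auto
    moreover have "\<pi> i \<noteq> \<pi> (Suc i)" using involutions_321_invol[OF \<pi>] by (metis n_not_Suc_n)
    ultimately show "\<pi> (Suc i) < \<pi> i" by (auto simp: openers_def closers_def)
  next
    assume d: "\<pi> (Suc i) < \<pi> i"
    have "i \<in> U"
    proof (rule ccontr)
      assume "i \<notin> U"
      then have "i \<notin> openers \<pi>" using EU by blast
      then have "\<pi> i \<le> i" by (simp add: openers_def)
      then have c: "\<pi> (Suc i) < i" using d by simp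
      show False
      proof (cases "\<pi> i = i")
        case True
        then show ?thesis using no_fixed_point_under_arc'[OF \<pi> c] by simp
      next
        case False
        then have "i \<in> closers \<pi>" "Suc i \<in> closers \<pi>" using \<open>\<pi> i \<le> i\<close> c by (auto simp: closers_def)
        then show ?thesis using strict_mono_onD[OF strict_mono_on_closers[OF \<pi>], of i "Suc i"] d by simp
      qed
    qed
    moreover have "Suc i \<notin> U"
    proof
      assume "Suc i \<in> U"
      then have "Suc i \<notin> closers \<pi>" using EU by blast
      then have "Suc i \<le> \<pi> (Suc i)" by (simp add: closers_def)
      then have c: "Suc i < \<pi> i" using d by simp
      show False
      proof (cases "\<pi> (Suc i) = Suc i")
        case True
        then show ?thesis using no_fixed_point_under_arc[OF \<pi> _ c] by simp
      next
        case False
        then have "i \<in> openers \<pi>" "Suc i \<in> openers \<pi>" using \<open>Suc i \<le> \<pi> (Suc i)\<close> c by (auto simp: openers_def)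
        then show ?thesis using strict_mono_onD[OF strict_mono_on_openers[OF \<pi>], of i "Suc i"] d by simp
      qed
    qed
    ultimately show "i \<in> U \<and> Suc i \<notin> U" ..
  qed
  then show ?thesis unfolding descents_def peaks_def by auto
qed

text \<open>Involutions and words are linked only by the relation \<open>flats_split\<close>; unique
  partners on both sides make it a bijection.\<close>

lemma ex_bij_betw_of_relation:
  assumes "\<And>a. a \<in> A \<Longrightarrow> \<exists>!b. b \<in> B \<and> R a b" and "\<And>b. b \<in> B \<Longrightarrow> \<exists>!a. a \<in> A \<and> R a b"
  obtains f where "bij_betw f A B" and "\<And>a. a \<in> A \<Longrightarrow> R a (f a)"
proof -
  define f where "f a = (THE b. b \<in> B \<and> R a b)" for a
  have f: "f a \<in> B \<and> R a (f a)" if "a \<in> A" for a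
    unfolding f_def by (rule theI'[OF assms(1)[OF that]])
  have "bij_betw f A B"
  proof (rule bij_betw_imageI)
    show "inj_on f A" using f assms(2) by (intro inj_onI) metis
    show "f ` A = B"
    proof
      show "B \<subseteq> f ` A"
      proof
        fix b assume b: "b \<in> B"
        then obtain a where a: "a \<in> A" "R a b" using assms(2) by blast
        then have "f a = b" using f assms(1) b by blast
        then show "b \<in> f ` A" using a by blast
      qed
    qed (use f in blast)
  qed
  then show thesis using that f by blast
qed

lemma ex_bij_betw_descents_peaks:
  "\<exists>f. bij_betw f {\<pi> \<in> involutions_321 n. descents n \<pi> = D}
    {U. U \<subseteq> {1..n} \<and> card U = (n + 1) div 2 \<and> peaks n U = D}"
proof -
  let ?B = "{U. U \<subseteq> {1..n} \<and> card U = (n + 1) div 2}"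
  let ?R = "\<lambda>\<pi> U. flats_split n (openers \<pi>) (closers \<pi>) U"
  have "\<exists>!U. U \<in> ?B \<and> ?R \<pi> U" if "\<pi> \<in> involutions_321 n" for \<pi>
    using ex1_word_of_ballot[OF ballot_openers_closers[OF that]] by simp
  moreover have "\<exists>!\<pi>. \<pi> \<in> involutions_321 n \<and> ?R \<pi> U" if "U \<in> ?B" for U
  proof (rule ex_ex1I)
    have U: "U \<subseteq> {1..n}" using that by simp
    then obtain E C where b: "ballot n E C" and "flats_split n E C U" using ex_ballot_of_word by blast
    then show "\<exists>\<pi>. \<pi> \<in> involutions_321 n \<and> ?R \<pi> U" using ex_involution_of_ballot[OF b] by metis
    fix \<pi> \<sigma> assume "\<pi> \<in> involutions_321 n \<and> ?R \<pi> U" "\<sigma> \<in> involutions_321 n \<and> ?R \<sigma> U"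
    then show "\<pi> = \<sigma>"
      using ballot_of_word_unique[OF ballot_openers_closers ballot_openers_closers _ _ U]
        openers_closers_inj by metis
  qed
  ultimately obtain f where f: "bij_betw f (involutions_321 n) ?B"
    and R: "\<And>\<pi>. \<pi> \<in> involutions_321 n \<Longrightarrow> ?R \<pi> (f \<pi>)"
    using ex_bij_betw_of_relation[of "involutions_321 n" ?B ?R] by blast
  have peaks: "descents n \<pi> = peaks n (f \<pi>)" if "\<pi> \<in> involutions_321 n" for \<pi>
    using descents_eq_peaks[OF that _ R[OF that]] bij_betwE[OF f] that by blast
  have "f ` {\<pi> \<in> involutions_321 n. descents n \<pi> = D} = {U \<in> ?B. peaks n U = D}" (is "f ` ?A = ?C")
  proof
    show "f ` ?A \<subseteq> ?C"
      using peaks[symmetric] bij_betwE[OF f] by (intro image_subsetI) simp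
    show "?C \<subseteq> f ` ?A"
    proof
      fix U assume U: "U \<in> ?C"
      then obtain \<pi> where "\<pi> \<in> involutions_321 n" "U = f \<pi>"
        using bij_betw_imp_surj_on[OF f] by blast
      then show "U \<in> f ` ?A" using U peaks[of \<pi>] by simp
    qed
  qed
  moreover have "{U \<in> ?B. peaks n U = D} = {U. U \<subseteq> {1..n} \<and> card U = (n + 1) div 2 \<and> peaks n U = D}"
    by blast
  ultimately show ?thesis
    using bij_betw_subset[OF f, of "{\<pi> \<in> involutions_321 n. descents n \<pi> = D}"] by auto
qed

section \<open>Words and strict chains\<close>

text \<open>With up-steps and down-steps drawn in the two coordinate directions, these are the
  points where the lattice path turns at a peak.\<close>

definition corners :: "nat \<Rightarrow> nat set \<Rightarrow> (nat \<times> nat) set" where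
  "corners n U = (\<lambda>i. (card (U \<inter> {..i}), card ({1..i} - U))) ` peaks n U"

lemma card_prefix:
  assumes "U \<subseteq> {1..n}"
  shows "card (U \<inter> {..i}) + card ({1..i} - U) = i"
proof -
  have "U \<inter> {..i} = {1..i} \<inter> U" using assms by auto
  then show ?thesis using card_Int_Diff[of "{1..i}" U] by simp
qed

lemma sums_corners:
  assumes "U \<subseteq> {1..n}"
  shows "(\<lambda>(a, b). a + b) ` corners n U = peaks n U"
  unfolding corners_def using card_prefix[OF assms] by (simp add: image_image)

text \<open>From a peak \<open>i\<close> to a later peak \<open>j\<close> both counts grow:
  \<open>Suc i\<close> is a down-step and \<open>j\<close> an up-step.\<close>

lemma strict_chain_corners: "strict_chain (corners n U)"
proof -
  have lt: "card (U \<inter> {..i}) < card (U \<inter> {..j}) \<and> card ({1..i} - U) < card ({1..j} - U)"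
    if "i \<in> peaks n U" "j \<in> peaks n U" "i < j" for i j
  proof
    show "card (U \<inter> {..i}) < card (U \<inter> {..j})"
      using that by (intro card_below_less) (auto simp: peaks_def)
    have "Suc i \<in> {1..j} - U" using that by (auto simp: peaks_def)
    moreover have "Suc i \<notin> {1..i} - U" "{1..i} - U \<subseteq> {1..j} - U" using that(3) by auto
    ultimately have "{1..i} - U \<subset> {1..j} - U" by blast
    then show "card ({1..i} - U) < card ({1..j} - U)" by (intro psubset_card_mono) auto
  qed
  show ?thesis
    unfolding strict_chain_def corners_def
  proof clarsimp
    fix i j assume ij: "i \<in> peaks n U" "j \<in> peaks n U"
    show "card (U \<inter> {..i}) < card (U \<inter> {..j}) \<longleftrightarrow> card ({Suc 0..i} - U) < card ({Suc 0..j} - U)"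
      using lt[OF ij] lt[OF ij(2,1)] by (cases i j rule: linorder_cases) auto
  qed
qed

text \<open>The peak itself is an up-step of the prefix, and a down-step follows it: hence the lower
  bound 1 and the strict upper bound.\<close>

lemma corners_subset:
  assumes "U \<subseteq> {1..n}"
  shows "corners n U \<subseteq> {1..card U} \<times> {..<n - card U}"
proof -
  have fin: "finite U" using assms finite_subset by blast
  have "1 \<le> card (U \<inter> {..i})" "card (U \<inter> {..i}) \<le> card U" "card ({1..i} - U) < n - card U"
    if "i \<in> peaks n U" for i
  proof -
    have "i \<in> U \<inter> {..i}" using that by (auto simp: peaks_def)
    then have "0 < card (U \<inter> {..i})" using fin by (auto simp: card_gt_0_iff)
    then show "1 \<le> card (U \<inter> {..i})" by simp
    show "card (U \<inter> {..i}) \<le> card U" using fin by (intro card_mono) auto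
    have "Suc i \<in> {1..n} - U" using that by (auto simp: peaks_def)
    moreover have "Suc i \<notin> {1..i} - U" "{1..i} - U \<subseteq> {1..n} - U" using that by (auto simp: peaks_def)
    ultimately have "{1..i} - U \<subset> {1..n} - U" by blast
    then have "card ({1..i} - U) < card ({1..n} - U)" by (intro psubset_card_mono) auto
    then show "card ({1..i} - U) < n - card U" using assms fin by (simp add: card_Diff_subset)
  qed
  then show ?thesis unfolding corners_def by auto
qed

text \<open>From an up-step on, a word keeps rising until its next peak. So at the first difference of
  two words with equal peaks, the one that rises has more up-steps at the next peak.\<close>

lemma corners_inj_aux:
  assumes U: "U \<subseteq> {1..n}" and V: "V \<subseteq> {1..n}" and "card U = card V" and peaks: "peaks n U = peaks n V"
    and count: "\<And>j. j \<in> peaks n U \<Longrightarrow> card (U \<inter> {..j}) = card (V \<inter> {..j})"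
    and i: "i \<in> U" "i \<notin> V" and same: "U \<inter> {..<i} = V \<inter> {..<i}"
  shows False
proof -
  have fin: "finite U" "finite V" using U V finite_subset by blast+
  \<comment> \<open>The end \<open>n\<close> is a last checkpoint in case no further peak follows;
    the counts agree there because the words have equal size.\<close>
  define P where "P = {j \<in> insert n (peaks n U). i \<le> j}"
  have finP: "finite P" and "n \<in> P" using i U by (auto simp: P_def peaks_def)
  define j where "j = Min P"
  have j: "j \<in> P" using Min_in[OF finP] \<open>n \<in> P\<close> by (auto simp: j_def)
  have j_le: "j \<le> n" using j by (auto simp: P_def peaks_def)
  have "i + k \<in> U" if "i + k \<le> j" for k using that
  proof (induction k)
    case (Suc k)
    have "i + k \<notin> P" using Min_le[OF finP, of "i + k"] Suc.prems by (auto simp: j_def)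
    then show ?case using Suc j_le i U by (auto simp: P_def peaks_def)
  qed (simp add: i)
  then have "{i..j} \<subseteq> U" by (metis atLeastAtMost_iff le_Suc_ex subsetI)
  have "U \<inter> {..n} = U" "V \<inter> {..n} = V" using U V by auto
  then have eq: "card (U \<inter> {..j}) = card (V \<inter> {..j})"
    using j count[of j] assms(3) by (auto simp: P_def)
  have "V \<inter> {..j} \<subseteq> U \<inter> {..j}"
  proof
    fix x assume x: "x \<in> V \<inter> {..j}"
    show "x \<in> U \<inter> {..j}"
    proof (cases "x < i")
      case True
      then show ?thesis using x same by blast
    next
      case False
      then show ?thesis using x \<open>{i..j} \<subseteq> U\<close> by auto
    qed
  qed
  moreover have "i \<in> U \<inter> {..j}" "i \<notin> V \<inter> {..j}" using i j by (auto simp: P_def)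
  ultimately have "V \<inter> {..j} \<subset> U \<inter> {..j}" by blast
  then have "card (V \<inter> {..j}) < card (U \<inter> {..j})" by (intro psubset_card_mono) auto
  then show False using eq by simp
qed

lemma corners_inj:
  assumes U: "U \<subseteq> {1..n}" and V: "V \<subseteq> {1..n}" and card: "card U = card V"
    and eq: "corners n U = corners n V"
  shows "U = V"
proof (rule ccontr)
  assume "U \<noteq> V"
  have peaks: "peaks n U = peaks n V" using sums_corners[OF U] sums_corners[OF V] eq by simp
  have count: "card (U \<inter> {..j}) = card (V \<inter> {..j})" if "j \<in> peaks n U" for j
  proof -
    have "(card (U \<inter> {..j}), card ({1..j} - U)) \<in> corners n V"
      using that eq unfolding corners_def by blast
    then obtain l where l: "card (U \<inter> {..j}) = card (V \<inter> {..l})" "card ({1..j} - U) = card ({1..l} - V)"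
      unfolding corners_def by blast
    \<comment> \<open>The coordinate sum is the position, so equal corners come from the same
      peak.\<close>
    then have "j = l" using card_prefix[OF U, of j] card_prefix[OF V, of l] by simp
    then show ?thesis using l by simp
  qed
  define i where "i = (LEAST i. i \<in> U \<longleftrightarrow> i \<notin> V)"
  have "\<exists>i. i \<in> U \<longleftrightarrow> i \<notin> V" using \<open>U \<noteq> V\<close> by blast
  then have i: "i \<in> U \<longleftrightarrow> i \<notin> V" unfolding i_def by (rule LeastI_ex)
  have same: "U \<inter> {..<i} = V \<inter> {..<i}" using not_less_Least unfolding i_def by blast
  show False
  proof (cases "i \<in> U")
    case True
    then show ?thesis using corners_inj_aux[OF U V card peaks count _ _ same] i by blast
  next
    case False
    then show ?thesis
      using corners_inj_aux[OF V U card[symmetric] peaks[symmetric] _ _ _ same[symmetric]] i count peaks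
      by simp
  qed
qed

text \<open>Below its top point \<open>(a, b)\<close> the chain lies in a smaller box, so a shorter
  word realises it and is extended by one last peak.\<close>

lemma corners_surj:
  assumes "finite S" and "strict_chain S" and "S \<subseteq> {1..p} \<times> {..<q}"
  shows "\<exists>U\<subseteq>{1..p + q}. card U = p \<and> corners (p + q) U = S"
  using assms
proof (induction arbitrary: p q rule: strict_chain_induct)
  case empty
  \<comment> \<open>In a word without peaks all \<open>q\<close> down-steps come before the
    \<open>p\<close> up-steps.\<close>
  have "peaks (p + q) {q + 1..p + q} = {}" by (auto simp: peaks_def)
  then show ?case by (intro exI[of _ "{q + 1..p + q}"]) (auto simp: corners_def)
next
  case (insert a b S)
  have ab: "1 \<le> a" "a \<le> p" "b < q" using insert.prems by auto
  have "S \<subseteq> {1..a - 1} \<times> {..<b}" using insert.hyps(3) insert.prems by fastforce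
  then obtain U where U: "U \<subseteq> {1..a - 1 + b}" "card U = a - 1" "corners (a - 1 + b) U = S"
    using insert.IH by blast
  have fin: "finite U" using U(1) finite_subset by blast
  \<comment> \<open>After the word \<open>U\<close> of length \<open>a - 1 + b\<close> come an
    up-step at \<open>a + b\<close>, the remaining \<open>q - b\<close> down-steps and the remaining
    \<open>p - a\<close> up-steps; the only new peak is \<open>a + b\<close>.\<close>
  define V where "V = U \<union> {a + b} \<union> {a + q + 1..p + q}"
  have U_range: "1 \<le> x \<and> x < a + b" if "x \<in> U" for x
  proof -
    have "x \<in> {1..a - 1 + b}" using that U(1) by blast
    then show ?thesis using ab by auto
  qed
  then have U_less: "x < a + b" if "x \<in> U" for x using that by blast
  have V: "V \<subseteq> {1..p + q}" using ab by (auto simp: V_def dest: U_range)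
  have "card (U \<union> {a + b}) = a" using U(2) U_less fin ab by (subst card_Un_disjoint) auto
  moreover have "card V = card (U \<union> {a + b}) + card {a + q + 1..p + q}"
    unfolding V_def using U_less fin ab by (intro card_Un_disjoint) (auto dest!: U_less)
  ultimately have cV: "card V = p" using ab by simp
  have mem: "x \<in> V \<longleftrightarrow> x \<in> U" if "x < a + b" for x using that ab by (auto simp: V_def)
  have mem': "x \<in> V \<longleftrightarrow> a + q + 1 \<le> x \<and> x \<le> p + q" if "a + b < x" for x
    using that ab by (auto simp: V_def dest: U_less)
  have top: "a + b \<in> V" by (simp add: V_def)
  have pk: "peaks (p + q) V = insert (a + b) (peaks (a - 1 + b) U)"
  proof (rule set_eqI)
    fix x
    consider "x + 1 < a + b" | "x + 1 = a + b" | "x = a + b" | "a + b < x" by linarith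
    then show "x \<in> peaks (p + q) V \<longleftrightarrow> x \<in> insert (a + b) (peaks (a - 1 + b) U)"
    proof cases
      case 1
      then show ?thesis using mem[of x] mem[of "Suc x"] ab by (auto simp: peaks_def)
    next
      case 2
      \<comment> \<open>This position ends the old word and is followed by an up-step in the new
        one, so it is a peak of neither.\<close>
      then have "\<not> x < a - 1 + b" "Suc x \<in> V" using top ab by auto
      then show ?thesis using 2 by (auto simp: peaks_def)
    next
      case 3
      then show ?thesis using top mem'[of "Suc x"] ab by (auto simp: peaks_def)
    next
      case 4
      then show ?thesis using mem'[of x] mem'[of "Suc x"] by (auto simp: peaks_def)
    qed
  qed
  have pre: "V \<inter> {..i} = U \<inter> {..i}" "{1..i} - V = {1..i} - U" if "i < a + b" for i
    using that mem by auto
  have "V \<inter> {..a + b} = U \<union> {a + b}" using ab by (auto simp: V_def dest: U_less)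
  then have "card (V \<inter> {..a + b}) = a" using \<open>card (U \<union> {a + b}) = a\<close> by simp
  moreover from this have "card ({1..a + b} - V) = b" using card_prefix[OF V, of "a + b"] by simp
  moreover have "(\<lambda>i. (card (V \<inter> {..i}), card ({1..i} - V))) ` peaks (a - 1 + b) U = S"
    unfolding U(3)[symmetric] corners_def using ab pre by (intro image_cong) (auto simp: peaks_def)
  ultimately have "corners (p + q) V = insert (a, b) S" unfolding corners_def pk by simp
  then show ?case using V cV by blast
qed

lemma bij_betw_corners:
  "bij_betw (corners n)
    {U. U \<subseteq> {1..n} \<and> card U = (n + 1) div 2 \<and> peaks n U = D}
    {S. S \<subseteq> {1..(n + 1) div 2} \<times> {..<n div 2} \<and> strict_chain S \<and> (\<lambda>(a, b). a + b) ` S = D}"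
    (is "bij_betw _ ?A ?B")
proof (rule bij_betw_imageI)
  have n: "n - (n + 1) div 2 = n div 2" "(n + 1) div 2 + n div 2 = n" by presburger+
  show "inj_on (corners n) ?A"
  proof (rule inj_onI)
    fix U V assume "U \<in> ?A" "V \<in> ?A" "corners n U = corners n V"
    then show "U = V" by (intro corners_inj[of U n V]) auto
  qed
  show "corners n ` ?A = ?B"
  proof
    show "corners n ` ?A \<subseteq> ?B"
    proof (rule image_subsetI)
      fix U assume "U \<in> ?A"
      then show "corners n U \<in> ?B"
        using corners_subset[of U n] sums_corners[of U n] strict_chain_corners[of n U] n(1) by simp
    qed
    show "?B \<subseteq> corners n ` ?A"
    proof
      fix S assume S: "S \<in> ?B"
      then have "finite S" by (auto intro: finite_subset)
      then obtain U where "U \<subseteq> {1..n}" "card U = (n + 1) div 2" "corners n U = S"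
        using corners_surj[of S "(n + 1) div 2" "n div 2"] S n(2) by auto
      then show "S \<in> corners n ` ?A" using sums_corners[of U n] S by blast
    qed
  qed
qed

theorem theorem3p4:
  fixes n m :: nat and D :: "nat set"
  assumes "D \<subseteq> {1..<n}" and "m = \<Sum>D"
  shows "\<exists>f. bij_betw f
    {\<pi> \<in> involutions_321 n. descents n \<pi> = D}
    {ps. is_partition ps m \<and> hook_decomposition ps = D \<and> young ps \<subseteq> box n}"
proof -
  obtain f where "bij_betw f {\<pi> \<in> involutions_321 n. descents n \<pi> = D}
    {U. U \<subseteq> {1..n} \<and> card U = (n + 1) div 2 \<and> peaks n U = D}"
    using ex_bij_betw_descents_peaks by blast
  \<comment> \<open>Words and partitions are both in bijection with the same set of chains, so the
    second bijection is inverted.\<close>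
  from bij_betw_trans[OF bij_betw_trans[OF this bij_betw_corners] bij_betw_inv_into[OF bij_betw_frobenius]]
  show ?thesis unfolding assms(2) by blast
qed

end
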